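(* Let $(X,d)$ be a nonempty metric space, let $u\in F_{USCG}(X)$, and let $\{u_n\}_{n\ge1}$ be a sequence in $F_{USCG}(X)$. Then the following properties are equivalent. (i) $H_{\rm end}(u_n,u)\to0$ as $n\to\infty$. (ii) $\lim_{n\to\infty}^{(\Gamma)}u_n=u$, and for each $\alpha\in(0,1]$, $\bigcup_{n=1}^{+\infty}[u_n]_\alpha$ is relatively compact in $(X,d)$. (iii) $\lim_{n\to\infty}^{(\Gamma)}u_n=u$, and for each $\alpha\in(0,1]$, $\bigcup_{n=1}^{+\infty}[u_n]_\alpha\cup[u]_\alpha$ is compact in $(X,d)$. (iv) $\lim_{n\to\infty}^{(\Gamma)}u_n=u$, $\{u_n: n=1,2,\ldots\}\cup\{u\}$ is closed in $(F_{USCG}(X),H_{\rm end})$, and for each $\alpha\in(0,1]$, $\bigcup_{n=1}^{+\infty}[u_n]_\alpha\cup[u]_\alpha$ is compact in $(X,d)$.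
   Context: A fuzzy set in $X$ is a function $u:X\to[0,1]$. For $\alpha\in(0,1]$, $[u]_\alpha=\{x\in X: u(x)\ge\alpha\}$, and $[u]_0=\overline{\{x\in X: u(x)>0\}}$ (closure in $X$). $F_{USC}(X)$ is the set of fuzzy sets $u$ in $X$ such that $[u]_\alpha$ is closed (possibly empty) for all $\alpha\in[0,1]$ (the upper semicontinuous fuzzy sets), and $F_{USCG}(X)$ is the set of $u\in F_{USC}(X)$ such that $[u]_\alpha$ is compact (possibly empty) for all $\alpha\in(0,1]$. $X\times[0,1]$ carries the metric $\overline d((x,\alpha),(y,\beta))=d(x,y)+|\alpha-\beta|$. The endograph of $u$ is ${\rm end}\,u=\{(x,t)\in X\times[0,1]: u(x)\ge t\}$; for $u\in F_{USC}(X)$ it is a nonempty closed set. For nonempty closed $A,B\subseteq X\times[0,1]$, $H(A,B)=\max\{\sup_{a\in A}\inf_{b\in B}\overline d(a,b),\ \sup_{b\in B}\inf_{a\in A}\overline d(a,b)\}$. The endograph metric on $F_{USC}(X)$ and its subsets is $H_{\rm end}(u,v)=H({\rm end}\,u,{\rm end}\,v)$. For sets $C_n$ in a metric space $Z$: $\liminf_n C_n=\{z: z=\lim_n z_n\text{ for some }z_n\in C_n\}$, and $\limsup_n C_n=\{z: z=\lim_j z_{n_j}\text{ for some subsequence }n_1<n_2<\cdots\text{ and }z_{n_j}\in C_{n_j}\}$; $\{C_n\}$ Kuratowski converges to $C$ if $C=\liminf_n C_n=\limsup_n C_n$. $\lim^{(\Gamma)}_{n\to\infty}u_n=u$ ($\Gamma$-convergence)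 means that $\{{\rm end}\,u_n\}$ Kuratowski converges to ${\rm end}\,u$ in $(X\times[0,1],\overline d)$. A subset $A$ of a metric space $Z$ is relatively compact in $Z$ if its closure in $Z$ is compact. *)

theory Defs
  imports "HOL-Analysis.Analysis"
begin

section \<open>Fuzzy sets in a metric space\<close>

text \<open>The nonempty metric space \<open>X\<close> is the type \<open>'a :: metric_space\<close>. A fuzzy set is a function
  \<open>'a \<Rightarrow> real\<close> belonging to \<open>fuzzy_sets\<close>.\<close>

definition fuzzy_sets :: "('a \<Rightarrow> real) set" where
  "fuzzy_sets = {u. \<forall>x. 0 \<le> u x \<and> u x \<le> 1}"

text \<open>The cut \<open>[u]\<^sub>\<alpha>\<close>, meant for \<open>\<alpha> \<in> {0..1}\<close>.\<close>

definition alpha_cut :: "real \<Rightarrow> ('a::metric_space \<Rightarrow> real) \<Rightarrow> 'a set" where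
  "alpha_cut \<alpha> u = (if \<alpha> = 0 then closure {x. u x > 0} else {x. u x \<ge> \<alpha>})"

definition F_USC :: "('a::metric_space \<Rightarrow> real) set" where
  "F_USC = {u \<in> fuzzy_sets. \<forall>\<alpha>\<in>{0..1}. closed (alpha_cut \<alpha> u)}"

definition F_USCG :: "('a::metric_space \<Rightarrow> real) set" where
  "F_USCG = {u \<in> F_USC. \<forall>\<alpha>\<in>{0<..1}. compact (alpha_cut \<alpha> u)}"

text \<open>The space \<open>X \<times> [0,1]\<close> with the sum metric (the \<open>dist\<close> of the product type
  is the Euclidean combination instead).\<close>

definition X01 :: "('a \<times> real) set" where
  "X01 = UNIV \<times> {0..1}"

definition dbar :: "'a::metric_space \<times> real \<Rightarrow> 'a \<times> real \<Rightarrow> real" where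
  "dbar p q = dist (fst p) (fst q) + \<bar>snd p - snd q\<bar>"

lemma Metric_space_dbar: "Metric_space X01 (dbar :: 'a::metric_space \<times> real \<Rightarrow> _)"
proof
  fix p q r :: "'a \<times> real"
  show "0 \<le> dbar p q" by (simp add: dbar_def)
  show "dbar p q = dbar q p" by (simp add: dbar_def dist_commute)
  show "dbar p q = 0 \<longleftrightarrow> p = q"
    by (auto simp: dbar_def prod_eq_iff add_nonneg_eq_0_iff)
  show "dbar p r \<le> dbar p q + dbar q r"
    using dist_triangle[of "fst p" "fst r" "fst q"] by (simp add: dbar_def)
qed

definition endograph :: "('a \<Rightarrow> real) \<Rightarrow> ('a \<times> real) set" where
  "endograph u = {(x, t). 0 \<le> t \<and> t \<le> 1 \<and> u x \<ge> t}"

section \<open>Hausdorff and endograph metric\<close>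

text \<open>\<open>H(A,B)\<close> may be infinite in general, hence \<open>ereal\<close>; on endographs it is at most 1
  (lemma \<open>hausdorff_endograph\<close>), so that \<open>H_end\<close> below loses nothing by passing to \<open>real\<close>.\<close>

definition hausdorff :: "('z \<Rightarrow> 'z \<Rightarrow> real) \<Rightarrow> 'z set \<Rightarrow> 'z set \<Rightarrow> ereal" where
  "hausdorff d A B =
     max (SUP a\<in>A. INF b\<in>B. ereal (d a b)) (SUP b\<in>B. INF a\<in>A. ereal (d a b))"

definition H_end :: "('a::metric_space \<Rightarrow> real) \<Rightarrow> ('a \<Rightarrow> real) \<Rightarrow> real" where
  "H_end u v = real_of_ereal (hausdorff dbar (endograph u) (endograph v))"

lemma hausdorff_le:
  assumes "\<And>a. a \<in> A \<Longrightarrow> \<exists>b\<in>B. d a b \<le> r" and "\<And>b. b \<in> B \<Longrightarrow> \<exists>a\<in>A. d a b \<le> r"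
  shows "hausdorff d A B \<le> ereal r"
  unfolding hausdorff_def
proof (intro max.boundedI SUP_least)
  fix a assume "a \<in> A"
  then obtain b where "b \<in> B" "d a b \<le> r" using assms(1) by blast
  then show "(INF b\<in>B. ereal (d a b)) \<le> ereal r" by (intro INF_lower2[of b]) auto
next
  fix b assume "b \<in> B"
  then obtain a where "a \<in> A" "d a b \<le> r" using assms(2) by blast
  then show "(INF a\<in>A. ereal (d a b)) \<le> ereal r" by (intro INF_lower2[of a]) auto
qed

lemma hausdorff_less:
  assumes "hausdorff d A B < ereal r"
  shows "a \<in> A \<Longrightarrow> \<exists>b\<in>B. d a b < r" and "b \<in> B \<Longrightarrow> \<exists>a\<in>A. d a b < r"
proof -
  have 1: "(SUP a\<in>A. INF b\<in>B. ereal (d a b)) < ereal r"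
    and 2: "(SUP b\<in>B. INF a\<in>A. ereal (d a b)) < ereal r"
    using assms by (auto simp: hausdorff_def)
  show "\<exists>b\<in>B. d a b < r" if "a \<in> A"
  proof -
    have "(INF b\<in>B. ereal (d a b)) < ereal r"
      using 1 that by (meson SUP_lessD)
    then show ?thesis by (simp add: INF_less_iff)
  qed
  show "\<exists>a\<in>A. d a b < r" if "b \<in> B"
  proof -
    have "(INF a\<in>A. ereal (d a b)) < ereal r"
      using 2 that by (meson SUP_lessD)
    then show ?thesis by (simp add: INF_less_iff)
  qed
qed

lemma hausdorff_commute:
  assumes "\<And>a b. d a b = d b a"
  shows "hausdorff d A B = hausdorff d B A"
proof -
  have "(SUP b\<in>Y. INF a\<in>X. ereal (d a b)) = (SUP b\<in>Y. INF a\<in>X. ereal (d b a))" for X Y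
    by (intro SUP_cong INF_cong refl arg_cong[of _ _ ereal] assms)
  then show ?thesis unfolding hausdorff_def by (simp only: max.commute)
qed

lemma endograph_base: "u \<in> fuzzy_sets \<Longrightarrow> (x, 0) \<in> endograph u"
  by (simp add: endograph_def fuzzy_sets_def)

lemma hausdorff_endograph:
  assumes "u \<in> fuzzy_sets" "v \<in> fuzzy_sets"
  shows "hausdorff dbar (endograph u) (endograph v) \<le> 1"
    and "hausdorff dbar (endograph u) (endograph v) = ereal (H_end u v)"
    and "0 \<le> H_end u v"
proof -
  let ?h = "hausdorff dbar (endograph u) (endograph v)"
  have "?h \<le> ereal 1"
  proof (rule hausdorff_le)
    fix a assume "a \<in> endograph u"
    then show "\<exists>b\<in>endograph v. dbar a b \<le> 1"
      using endograph_base[OF assms(2), of "fst a"]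
      by (intro bexI[of _ "(fst a, 0)"]) (auto simp: endograph_def dbar_def)
  next
    fix b assume "b \<in> endograph v"
    then show "\<exists>a\<in>endograph u. dbar a b \<le> 1"
      using endograph_base[OF assms(1), of "fst b"]
      by (intro bexI[of _ "(fst b, 0)"]) (auto simp: endograph_def dbar_def)
  qed
  then show le: "?h \<le> 1" by (simp add: one_ereal_def)
  have "0 \<le> (INF b\<in>endograph v. ereal (dbar (undefined, 0) b))"
    by (rule INF_greatest) (simp add: dbar_def)
  also have "\<dots> \<le> (SUP a\<in>endograph u. INF b\<in>endograph v. ereal (dbar a b))"
    by (rule SUP_upper) (rule endograph_base[OF assms(1)])
  also have "\<dots> \<le> ?h" by (simp add: hausdorff_def)
  finally have ge: "0 \<le> ?h" .
  show "?h = ereal (H_end u v)"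
    using le ge by (cases ?h) (auto simp: H_end_def)
  then show "0 \<le> H_end u v" using ge by simp
qed

lemma endograph_subset_if_H_end_0:
  assumes u: "u \<in> fuzzy_sets" and v: "v \<in> F_USC" and 0: "H_end u v = 0"
  shows "u x \<le> v x"
proof (rule ccontr)
  assume "\<not> u x \<le> v x"
  then have lt: "v x < u x" by simp
  have v': "v \<in> fuzzy_sets" using v by (simp add: F_USC_def)
  define s where "s = (u x + v x) / 2"
  have ux: "0 \<le> u x" "u x \<le> 1" and vx: "0 \<le> v x" using u v' by (auto simp: fuzzy_sets_def)
  have s: "0 < s" "s \<le> 1" "v x < s" "s < u x" using lt ux vx by (auto simp: s_def)
  have "closed (alpha_cut s v)" using v s by (auto simp: F_USC_def)
  moreover have "x \<notin> alpha_cut s v" using s by (simp add: alpha_cut_def)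
  ultimately obtain e where e: "e > 0" "\<And>y. dist y x < e \<Longrightarrow> y \<notin> alpha_cut s v"
    by (metis Compl_iff closed_def open_dist)
  define r where "r = min e (u x - s)"
  have lt_r: "hausdorff dbar (endograph u) (endograph v) < ereal r"
    using hausdorff_endograph(2)[OF u v'] 0 e s by (simp add: r_def)
  have "(x, u x) \<in> endograph u" using ux by (simp add: endograph_def)
  then obtain b where b: "b \<in> endograph v" "dbar (x, u x) b < r"
    using hausdorff_less(1)[OF lt_r] by blast
  have "dist (fst b) x < e" "snd b > s"
    using b(2) zero_le_dist[of x "fst b"]
    unfolding dbar_def r_def fst_conv snd_conv dist_commute[of "fst b" x] by linarith+
  moreover have "snd b \<le> v (fst b)" using b(1) by (auto simp: endograph_def)
  ultimately show False using e(2)[of "fst b"] s by (auto simp: alpha_cut_def)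
qed

text \<open>\<open>H_end\<close> is a metric on \<open>F_USC\<close> and its subsets.\<close>

lemma Metric_space_H_end:
  assumes "S \<subseteq> F_USC"
  shows "Metric_space S H_end"
proof -
  have comm: "H_end u v = H_end v u" for u v :: "'a \<Rightarrow> real"
    unfolding H_end_def by (subst hausdorff_commute) (auto simp: dbar_def dist_commute)
  have nonneg: "0 \<le> H_end u v" for u v :: "'a \<Rightarrow> real"
  proof -
    have ne: "0 \<le> (SUP a\<in>A. INF b\<in>B. ereal (dbar a b))" if "A \<noteq> {}" for A B :: "('a \<times> real) set"
    proof -
      obtain a where "a \<in> A" using \<open>A \<noteq> {}\<close> by blast
      have "0 \<le> (INF b\<in>B. ereal (dbar a b))" by (rule INF_greatest) (simp add: dbar_def)
      then show ?thesis using \<open>a \<in> A\<close> by (meson SUP_upper2)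
    qed
    show ?thesis
    proof (cases "endograph u = {}")
      case True
      show ?thesis
      proof (cases "endograph v = {}")
        case True
        then show ?thesis using \<open>endograph u = {}\<close>
          by (simp add: H_end_def hausdorff_def bot_ereal_def)
      next
        case False
        then have "0 \<le> hausdorff dbar (endograph v) (endograph u)"
          using ne[OF False] by (simp add: hausdorff_def le_max_iff_disj)
        then show ?thesis using comm by (metis H_end_def real_of_ereal_pos)
      qed
    next
      case False
      then show ?thesis
        using ne[OF False] unfolding H_end_def hausdorff_def
        by (intro real_of_ereal_pos) (simp add: le_max_iff_disj)
    qed
  qed
  show ?thesis
  proof
    show "0 \<le> H_end u v" for u v :: "'a \<Rightarrow> real" by (rule nonneg)
    show "H_end u v = H_end v u" for u v :: "'a \<Rightarrow> real" by (rule comm)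
  next
    fix u v :: "'a \<Rightarrow> real" assume "u \<in> S" "v \<in> S"
    then have U: "u \<in> F_USC" "v \<in> F_USC" using assms by auto
    then have F: "u \<in> fuzzy_sets" "v \<in> fuzzy_sets" by (auto simp: F_USC_def)
    show "H_end u v = 0 \<longleftrightarrow> u = v"
    proof
      assume "H_end u v = 0"
      then show "u = v"
        using endograph_subset_if_H_end_0[OF F(1) U(2)] endograph_subset_if_H_end_0[OF F(2) U(1)]
        by (auto simp: comm fun_eq_iff intro: antisym)
    next
      assume "u = v"
      then have "hausdorff dbar (endograph u) (endograph v) \<le> ereal 0"
        by (intro hausdorff_le) (force simp: dbar_def)+
      then show "H_end u v = 0"
        using hausdorff_endograph(2)[OF F] nonneg[of u v] by simp
    qed
  next
    fix u v w :: "'a \<Rightarrow> real" assume "u \<in> S" "v \<in> S" "w \<in> S"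
    then have F: "u \<in> fuzzy_sets" "v \<in> fuzzy_sets" "w \<in> fuzzy_sets"
      using assms by (auto simp: F_USC_def)
    have tri: "dbar a c \<le> dbar a b + dbar b c" for a b c :: "'a \<times> real"
      using dist_triangle[of "fst a" "fst c" "fst b"] by (simp add: dbar_def)
    show "H_end u w \<le> H_end u v + H_end v w"
    proof (rule field_le_epsilon)
      fix e :: real assume "0 < e"
      have 1: "hausdorff dbar (endograph u) (endograph v) < ereal (H_end u v + e/2)"
        and 2: "hausdorff dbar (endograph v) (endograph w) < ereal (H_end v w + e/2)"
        using \<open>0 < e\<close> by (simp_all add: hausdorff_endograph(2) F)
      have "hausdorff dbar (endograph u) (endograph w) \<le> ereal (H_end u v + H_end v w + e)"
      proof (rule hausdorff_le)
        fix a assume "a \<in> endograph u"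
        then obtain b where "b \<in> endograph v" "dbar a b < H_end u v + e/2"
          using hausdorff_less(1)[OF 1] by blast
        moreover then obtain c where "c \<in> endograph w" "dbar b c < H_end v w + e/2"
          using hausdorff_less(1)[OF 2] by blast
        ultimately show "\<exists>c\<in>endograph w. dbar a c \<le> H_end u v + H_end v w + e"
          using tri[of a c b] by (intro bexI[of _ c]) auto
      next
        fix c assume "c \<in> endograph w"
        then obtain b where "b \<in> endograph v" "dbar b c < H_end v w + e/2"
          using hausdorff_less(2)[OF 2] by blast
        moreover then obtain a where "a \<in> endograph u" "dbar a b < H_end u v + e/2"
          using hausdorff_less(2)[OF 1] by blast
        ultimately show "\<exists>a\<in>endograph u. dbar a c \<le> H_end u v + H_end v w + e"
          using tri[of a c b] by (intro bexI[of _ a]) auto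
      qed
      then show "H_end u w \<le> H_end u v + H_end v w + e"
        using hausdorff_endograph(2)[OF F(1,3)] by simp
    qed
  qed
qed

section \<open>Kuratowski convergence and \<open>\<Gamma>\<close>-convergence\<close>

text \<open>Here \<open>(Z, d)\<close> is a metric space and the \<open>C n\<close> are subsets of \<open>Z\<close>.\<close>

definition K_liminf :: "'z set \<Rightarrow> ('z \<Rightarrow> 'z \<Rightarrow> real) \<Rightarrow> (nat \<Rightarrow> 'z set) \<Rightarrow> 'z set" where
  "K_liminf Z d C =
     {z. \<exists>s. (\<forall>n. s n \<in> C n) \<and> limitin (Metric_space.mtopology Z d) s z sequentially}"

definition K_limsup :: "'z set \<Rightarrow> ('z \<Rightarrow> 'z \<Rightarrow> real) \<Rightarrow> (nat \<Rightarrow> 'z set) \<Rightarrow> 'z set" where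
  "K_limsup Z d C =
     {z. \<exists>r s. strict_mono (r :: nat \<Rightarrow> nat) \<and> (\<forall>j. s j \<in> C (r j)) \<and>
           limitin (Metric_space.mtopology Z d) s z sequentially}"

definition K_converges ::
  "'z set \<Rightarrow> ('z \<Rightarrow> 'z \<Rightarrow> real) \<Rightarrow> (nat \<Rightarrow> 'z set) \<Rightarrow> 'z set \<Rightarrow> bool" where
  "K_converges Z d C L \<longleftrightarrow> L = K_liminf Z d C \<and> L = K_limsup Z d C"

definition Gamma_converges ::
  "(nat \<Rightarrow> 'a::metric_space \<Rightarrow> real) \<Rightarrow> ('a \<Rightarrow> real) \<Rightarrow> bool" where
  "Gamma_converges u v \<longleftrightarrow> K_converges X01 dbar (\<lambda>n. endograph (u n)) (endograph v)"

definition relatively_compact :: "'a::topological_space set \<Rightarrow> bool" where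
  "relatively_compact A \<longleftrightarrow> compact (closure A)"

end

theory Submission
  imports Defs
begin

text \<open>
  All four properties compare the endographs of \<open>us n\<close> with that of \<open>u\<close>, and Hausdorff convergence
  to a closed set always implies Kuratowski convergence.  The converse fails in general because points
  of the \<open>n\<close>-th set may run off to infinity.  Here a point \<open>(x, t)\<close> of one endograph lies at
  distance at most \<open>t\<close> from any other endograph, which contains \<open>(x, 0)\<close>.  A failure of Hausdorff
  convergence by \<open>e\<close> is therefore witnessed by points of height at least \<open>e\<close>, whose first components
  lie in \<open>e\<close>-cuts.  The \<open>e\<close>-cut of \<open>u\<close> is compact; if the union of those of the \<open>us n\<close> is relatively
  compact, the witnesses accumulate, on whichever side they lie, at a point which Kuratowski
  convergence makes a limit of points of the other side as well, a contradiction.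
  This is \<open>H_end_tendsto_if_Gamma\<close>.

  Conversely, if \<open>H_end (us n) u\<close> tends to \<open>0\<close>, a sequence in the union of the \<open>\<alpha>\<close>-cuts either stays
  infinitely often in finitely many of them, which are compact, or, lifted to height \<open>\<alpha>\<close>, it comes closer and
  closer to the
  part of the endograph of \<open>u\<close> above height \<open>\<alpha>/2\<close>.  That part is compact, and the sequence
  subconverges to a point of the \<open>\<alpha>\<close>-cut of \<open>u\<close>.  This is \<open>compact_Union_cuts_if_H_end_tendsto\<close>; it gives
  the strong form of the compactness condition, which trivially implies relative compactness of the
  union without the cut of \<open>u\<close>.  The closedness condition is satisfied by any convergent sequence
  together with its limit in a Hausdorff space.
\<close>

section \<open>Endographs and the metric on the product\<close>

lemma F_USCG_fuzzy: "u \<in> F_USCG \<Longrightarrow> u \<in> fuzzy_sets"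
  by (simp add: F_USCG_def F_USC_def)

lemma alpha_cut_pos: "0 < \<alpha> \<Longrightarrow> alpha_cut \<alpha> u = {x. \<alpha> \<le> u x}"
  by (simp add: alpha_cut_def)

lemma endograph_iff: "p \<in> endograph u \<longleftrightarrow> 0 \<le> snd p \<and> snd p \<le> 1 \<and> snd p \<le> u (fst p)"
  by (cases p) (simp add: endograph_def)

lemma endograph_subset_X01: "endograph u \<subseteq> X01"
  by (auto simp: endograph_def X01_def)

lemma dbar_commute: "dbar p q = dbar q p"
  by (simp add: dbar_def dist_commute)

lemma dbar_nonneg: "0 \<le> dbar p q"
  by (simp add: dbar_def)

lemma tendsto_iff_dbar_tendsto_0:
  "(s \<longlongrightarrow> z) F \<longleftrightarrow> ((\<lambda>n. dbar (s n) z) \<longlongrightarrow> 0) F"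
proof
  assume "(s \<longlongrightarrow> z) F"
  then have "((\<lambda>n. fst (s n)) \<longlongrightarrow> fst z) F" "((\<lambda>n. snd (s n)) \<longlongrightarrow> snd z) F"
    by (auto intro: tendsto_fst tendsto_snd)
  then have "((\<lambda>n. dist (fst (s n)) (fst z) + dist (snd (s n)) (snd z)) \<longlongrightarrow> 0 + 0) F"
    unfolding tendsto_dist_iff[of _ "fst z"] tendsto_dist_iff[of _ "snd z"] by (rule tendsto_add)
  then show "((\<lambda>n. dbar (s n) z) \<longlongrightarrow> 0) F"
    by (simp add: dbar_def dist_real_def)
next
  assume *: "((\<lambda>n. dbar (s n) z) \<longlongrightarrow> 0) F"
  have "dist (s n) z \<le> dbar (s n) z" for n
    unfolding dbar_def dist_prod_def
    using sqrt_sum_squares_le_sum_abs[of "dist (fst (s n)) (fst z)" "dist (snd (s n)) (snd z)"]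
    by (simp add: dist_real_def)
  then have "((\<lambda>n. dist (s n) z) \<longlongrightarrow> 0) F"
    by (intro tendsto_sandwich[OF _ _ tendsto_const *]) auto
  then show "(s \<longlongrightarrow> z) F" by (simp add: tendsto_dist_iff[symmetric])
qed

text \<open>The sum metric induces the product topology, so that the limits in the definition of
  Kuratowski convergence are limits in the type \<open>'a \<times> real\<close>.\<close>

lemma limitin_dbar_iff:
  assumes "\<And>n. s n \<in> X01"
  shows "limitin (Metric_space.mtopology X01 dbar) s z sequentially \<longleftrightarrow> z \<in> X01 \<and> s \<longlonglongrightarrow> z"
proof -
  interpret Metric_space "X01 :: ('a::metric_space \<times> real) set" dbar by (rule Metric_space_dbar)
  show ?thesis
    using assms by (simp add: limitin_metric_dist_null tendsto_iff_dbar_tendsto_0)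
qed

text \<open>The ambient set \<open>X01\<close> is closed, hence disappears from the description of Kuratowski limits.\<close>

lemma limit_in_X01: "\<lbrakk>\<And>n. s n \<in> X01; s \<longlonglongrightarrow> z\<rbrakk> \<Longrightarrow> z \<in> X01"
  by (rule closed_sequentially[of X01]) (auto simp: X01_def intro!: closed_Times)

lemma K_liminf_endograph:
  "K_liminf X01 dbar (\<lambda>n. endograph (us n)) = {z. \<exists>s. (\<forall>n. s n \<in> endograph (us n)) \<and> s \<longlonglongrightarrow> z}"
proof -
  have "limitin (Metric_space.mtopology X01 dbar) s z sequentially \<longleftrightarrow> s \<longlonglongrightarrow> z"
    if "\<forall>n. s n \<in> endograph (us n)" for s z
  proof -
    have "s n \<in> X01" for n using that endograph_subset_X01 by blast
    then show ?thesis using limitin_dbar_iff limit_in_X01 by blast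
  qed
  then show ?thesis unfolding K_liminf_def by (intro Collect_cong ex_cong1 conj_cong refl)
qed

lemma K_limsup_endograph:
  "K_limsup X01 dbar (\<lambda>n. endograph (us n)) =
     {z. \<exists>r s. strict_mono (r :: nat \<Rightarrow> nat) \<and> (\<forall>j. s j \<in> endograph (us (r j))) \<and> s \<longlonglongrightarrow> z}"
proof -
  have "limitin (Metric_space.mtopology X01 dbar) s z sequentially \<longleftrightarrow> s \<longlonglongrightarrow> z"
    if "\<forall>j. s j \<in> endograph (us (r j))" for r s z
  proof -
    have "s n \<in> X01" for n using that endograph_subset_X01 by blast
    then show ?thesis using limitin_dbar_iff limit_in_X01 by blast
  qed
  then show ?thesis unfolding K_limsup_def by (intro Collect_cong ex_cong1 conj_cong refl)
qed

lemma closed_endograph: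
  assumes "u \<in> F_USC"
  shows "closed (endograph u)"
  unfolding closed_sequential_limits
proof (intro allI impI, elim conjE)
  fix p z assume p: "\<forall>n. p n \<in> endograph u" and lim: "p \<longlonglongrightarrow> z"
  note lim' = tendsto_fst[OF lim] tendsto_snd[OF lim]
  have "z \<in> X01" using p lim endograph_subset_X01 limit_in_X01 by blast
  then have z: "0 \<le> snd z" "snd z \<le> 1" by (auto simp: X01_def)
  moreover have "snd z \<le> u (fst z)"
  proof (rule ccontr)
    assume less: "\<not> snd z \<le> u (fst z)"
    \<comment> \<open>A level strictly between the two values is eventually exceeded along the sequence, and
        its cut is closed.\<close>
    define s where "s = (snd z + u (fst z)) / 2"
    have "0 \<le> u (fst z)" using assms by (simp add: F_USC_def fuzzy_sets_def)
    then have s: "0 < s" "s \<le> 1" "u (fst z) < s" "s < snd z"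
      using less z by (auto simp: s_def)
    have "closed (alpha_cut s u)" using assms s by (auto simp: F_USC_def)
    moreover have "\<forall>\<^sub>F n in sequentially. s < snd (p n)"
      using lim'(2) s(4) by (rule order_tendstoD)
    then have "\<forall>\<^sub>F n in sequentially. fst (p n) \<in> alpha_cut s u"
    proof (rule eventually_mono)
      fix n assume "s < snd (p n)"
      moreover have "snd (p n) \<le> u (fst (p n))" using p by (simp add: endograph_iff)
      ultimately show "fst (p n) \<in> alpha_cut s u" using s by (simp add: alpha_cut_pos)
    qed
    ultimately have "fst z \<in> alpha_cut s u"
      using lim'(1) by (metis Lim_in_closed_set trivial_limit_sequentially)
    then show False using s by (simp add: alpha_cut_pos)
  qed
  ultimately show "z \<in> endograph u" by (simp add: endograph_iff)
qed

text \<open>The full endograph contains a copy of \<open>X\<close> at height \<open>0\<close> and need not be compact.  It is this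
  truncation that supplies convergent subsequences.\<close>

lemma compact_endograph_above:
  assumes "u \<in> F_USCG" "0 < c" "c \<le> 1"
  shows "compact (endograph u \<inter> {p. c \<le> snd p})"
proof -
  have "closed (endograph u \<inter> {p. c \<le> snd p})"
    using assms by (intro closed_Int closed_endograph closed_Collect_le continuous_intros)
      (auto simp: F_USCG_def)
  moreover have "compact (alpha_cut c u \<times> {c..1})"
    using assms by (intro compact_Times) (auto simp: F_USCG_def)
  moreover have "endograph u \<inter> {p. c \<le> snd p} \<subseteq> alpha_cut c u \<times> {c..1}"
    using assms by (force simp: endograph_iff alpha_cut_pos)
  ultimately show ?thesis using compact_Int_closed by (fastforce simp: inf.absorb2)
qed

section \<open>From endograph convergence to Kuratowski convergence and compactness\<close>

lemma H_end_near:
  assumes "u \<in> fuzzy_sets" "v \<in> fuzzy_sets" "H_end u v < r"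
  shows "p \<in> endograph u \<Longrightarrow> \<exists>q\<in>endograph v. dbar p q < r"
    and "q \<in> endograph v \<Longrightarrow> \<exists>p\<in>endograph u. dbar p q < r"
  using hausdorff_less[of dbar "endograph u" "endograph v" r] assms
  by (simp_all add: hausdorff_endograph(2))

lemma dbar_tendsto_0_transfer:
  assumes "(\<lambda>n. dbar (p n) (q n)) \<longlonglongrightarrow> 0" and "p \<longlonglongrightarrow> z"
  shows "q \<longlonglongrightarrow> z"
proof -
  have "dbar (q n) z \<le> dbar (p n) (q n) + dbar (p n) z" for n
    using dist_triangle[of "fst (q n)" "fst z" "fst (p n)"]
    by (simp add: dbar_def dist_commute)
  moreover have "(\<lambda>n. dbar (p n) (q n) + dbar (p n) z) \<longlonglongrightarrow> 0 + 0"
    using assms by (intro tendsto_add) (simp_all add: tendsto_iff_dbar_tendsto_0)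
  ultimately have "(\<lambda>n. dbar (q n) z) \<longlonglongrightarrow> 0"
    using tendsto_sandwich[of "\<lambda>_. 0" "\<lambda>n. dbar (q n) z" sequentially
        "\<lambda>n. dbar (p n) (q n) + dbar (p n) z" 0]
    by (simp add: dbar_nonneg)
  then show ?thesis by (simp add: tendsto_iff_dbar_tendsto_0)
qed

text \<open>Almost best approximations exist; the summand \<open>1 / (k + 1)\<close> of the proof stands in for an
  attained infimum.\<close>

lemma H_end_approximating_sequence:
  assumes "u \<in> fuzzy_sets" "\<And>k. vs k \<in> fuzzy_sets" "(\<lambda>k. H_end (vs k) u) \<longlonglongrightarrow> 0"
  shows "(\<And>k. p k \<in> endograph (vs k)) \<Longrightarrow> \<exists>q. (\<forall>k. q k \<in> endograph u) \<and> (\<lambda>k. dbar (p k) (q k)) \<longlonglongrightarrow> 0"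
    and "(\<And>k. q k \<in> endograph u) \<Longrightarrow> \<exists>p. (\<forall>k. p k \<in> endograph (vs k)) \<and> (\<lambda>k. dbar (p k) (q k)) \<longlonglongrightarrow> 0"
proof -
  define r where "r k = H_end (vs k) u + 1 / real (Suc k)" for k
  have less: "H_end (vs k) u < r k" for k by (simp add: r_def)
  have "r \<longlonglongrightarrow> 0 + 0"
    unfolding r_def by (intro tendsto_add assms(3) LIMSEQ_Suc[OF lim_1_over_n])
  then have r0: "r \<longlonglongrightarrow> 0" by simp
  have squeeze: "(\<lambda>k. dbar (p k) (q k)) \<longlonglongrightarrow> 0" if "\<And>k. dbar (p k) (q k) < r k" for p q
  proof (rule tendsto_sandwich[OF _ _ tendsto_const r0])
    show "\<forall>\<^sub>F k in sequentially. 0 \<le> dbar (p k) (q k)" by (simp add: dbar_nonneg)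
    show "\<forall>\<^sub>F k in sequentially. dbar (p k) (q k) \<le> r k"
      using that by (simp add: less_imp_le)
  qed
  note near = H_end_near[OF assms(2,1) less]
  show "\<exists>q. (\<forall>k. q k \<in> endograph u) \<and> (\<lambda>k. dbar (p k) (q k)) \<longlonglongrightarrow> 0"
    if "\<And>k. p k \<in> endograph (vs k)"
  proof -
    have "\<forall>k. \<exists>q. q \<in> endograph u \<and> dbar (p k) q < r k"
      using near(1)[OF that] by (simp add: Bex_def)
    then obtain q where "\<forall>k. q k \<in> endograph u \<and> dbar (p k) (q k) < r k" by metis
    then show ?thesis using squeeze by blast
  qed
  show "\<exists>p. (\<forall>k. p k \<in> endograph (vs k)) \<and> (\<lambda>k. dbar (p k) (q k)) \<longlonglongrightarrow> 0"
    if "\<And>k. q k \<in> endograph u"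
  proof -
    have "\<forall>k. \<exists>p. p \<in> endograph (vs k) \<and> dbar p (q k) < r k"
      using near(2)[OF that] by (simp add: Bex_def)
    then obtain p where "\<forall>k. p k \<in> endograph (vs k) \<and> dbar (p k) (q k) < r k" by metis
    then show ?thesis using squeeze by blast
  qed
qed

text \<open>The inclusion \<open>liminf \<subseteq> limsup\<close> is general.  Almost best approximations in the endograph of \<open>u\<close>
  put the limsup into its closure, which is the endograph itself, and almost best approximations in
  the endographs of \<open>us n\<close> put the endograph of \<open>u\<close> into the liminf.\<close>

lemma Gamma_if_H_end_tendsto:
  assumes u: "u \<in> F_USC" and us: "\<And>n. us n \<in> fuzzy_sets"
    and H: "(\<lambda>n. H_end (us n) u) \<longlonglongrightarrow> 0"
  shows "Gamma_converges us u"
proof -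
  let ?L = "K_liminf X01 dbar (\<lambda>n. endograph (us n))"
  let ?S = "K_limsup X01 dbar (\<lambda>n. endograph (us n))"
  have u': "u \<in> fuzzy_sets" using u by (simp add: F_USC_def)
  have "?L \<subseteq> ?S"
  proof
    fix z assume "z \<in> ?L"
    then obtain s where "\<forall>n. s n \<in> endograph (us n)" "s \<longlonglongrightarrow> z"
      unfolding K_liminf_endograph by blast
    then show "z \<in> ?S"
      unfolding K_limsup_endograph by (auto intro!: exI[of _ id] exI[of _ s] simp: strict_mono_def)
  qed
  moreover have "?S \<subseteq> endograph u"
  proof
    fix z assume "z \<in> ?S"
    then obtain r s where r: "strict_mono (r :: nat \<Rightarrow> nat)"
      and s: "\<And>j. s j \<in> endograph (us (r j))" "s \<longlonglongrightarrow> z"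
      unfolding K_limsup_endograph by blast
    have "(\<lambda>j. H_end (us (r j)) u) \<longlonglongrightarrow> 0"
      using LIMSEQ_subseq_LIMSEQ[OF H r] by (simp add: o_def)
    then obtain q where q: "\<forall>j. q j \<in> endograph u" "(\<lambda>j. dbar (s j) (q j)) \<longlonglongrightarrow> 0"
      using H_end_approximating_sequence(1)[OF u', of "\<lambda>j. us (r j)" s] us s(1) by blast
    have "q \<longlonglongrightarrow> z" using dbar_tendsto_0_transfer[OF q(2) s(2)] .
    then show "z \<in> endograph u"
      using closed_sequentially[OF closed_endograph[OF u]] q(1) by blast
  qed
  moreover have "endograph u \<subseteq> ?L"
  proof
    fix z assume "z \<in> endograph u"
    then have "\<exists>p. (\<forall>n. p n \<in> endograph (us n)) \<and> (\<lambda>n. dbar (p n) z) \<longlonglongrightarrow> 0"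
      by (intro H_end_approximating_sequence(2)[OF u' us H])
    then show "z \<in> ?L"
      by (simp add: K_liminf_endograph tendsto_iff_dbar_tendsto_0)
  qed
  ultimately show ?thesis unfolding Gamma_converges_def K_converges_def by blast
qed

lemma subsequence_in_compact:
  fixes f :: "nat \<Rightarrow> 'b::metric_space"
  assumes "compact K" "\<exists>\<^sub>F k in sequentially. f k \<in> K"
  obtains l r where "l \<in> K" "strict_mono (r :: nat \<Rightarrow> nat)" "(f \<circ> r) \<longlonglongrightarrow> l"
proof -
  obtain r where r: "strict_mono (r :: nat \<Rightarrow> nat)" "\<And>j. f (r j) \<in> K"
    using not_eventually_sequentiallyD[of "\<lambda>k. f k \<notin> K"] assms(2)
    unfolding frequently_def by blast
  then obtain l s where "l \<in> K" "strict_mono (s :: nat \<Rightarrow> nat)" "((f \<circ> r) \<circ> s) \<longlonglongrightarrow> l"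
    using assms(1) unfolding compact_eq_seq_compact_metric seq_compact_def by (metis comp_apply)
  then show ?thesis
    using that[of l "r \<circ> s"] strict_mono_o[OF r(1), of s] by (simp add: o_assoc)
qed

text \<open>A sequence in the union that leaves each finite union of cuts has indices tending to infinity.
  Lifted to height \<open>\<alpha>\<close>, its terms approach the compact truncated endograph of \<open>u\<close>, and a limit point
  again has height \<open>\<alpha>\<close>, so that its first component lies in the cut of \<open>u\<close>.\<close>

lemma compact_Union_cuts_if_H_end_tendsto:
  fixes u :: "'a::metric_space \<Rightarrow> real"
  assumes u: "u \<in> F_USCG" and us: "\<And>n. us n \<in> F_USCG"
    and H: "(\<lambda>n. H_end (us n) u) \<longlonglongrightarrow> 0" and \<alpha>: "0 < \<alpha>" "\<alpha> \<le> 1"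
  shows "compact ((\<Union>n. alpha_cut \<alpha> (us n)) \<union> alpha_cut \<alpha> u)"
  unfolding compact_eq_seq_compact_metric seq_compact_def
proof (intro allI impI)
  let ?U = "(\<Union>n. alpha_cut \<alpha> (us n)) \<union> alpha_cut \<alpha> u"
  define K where "K N = (\<Union>n<N. alpha_cut \<alpha> (us n)) \<union> alpha_cut \<alpha> u" for N
  have K: "compact (K N)" for N
    unfolding K_def using u us \<alpha> by (intro compact_Un compact_UN) (auto simp: F_USCG_def)
  have K_sub: "K N \<subseteq> ?U" for N unfolding K_def by blast
  fix f :: "nat \<Rightarrow> 'a" assume f: "\<forall>k. f k \<in> ?U"
  show "\<exists>l\<in>?U. \<exists>r :: nat \<Rightarrow> nat. strict_mono r \<and> (f \<circ> r) \<longlonglongrightarrow> l"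
  proof (cases "\<exists>N. \<exists>\<^sub>F k in sequentially. f k \<in> K N")
    case True
    then obtain N where "\<exists>\<^sub>F k in sequentially. f k \<in> K N" ..
    with K obtain l r where "l \<in> K N" "strict_mono (r :: nat \<Rightarrow> nat)" "(f \<circ> r) \<longlonglongrightarrow> l"
      by (rule subsequence_in_compact)
    then show ?thesis using K_sub by blast
  next
    case False
    then have ev: "\<forall>\<^sub>F k in sequentially. f k \<notin> K N" for N
      by (simp add: not_frequently)
    \<comment> \<open>The finitely many terms in the cut of \<open>u\<close> have no index and are cut off by a shift.\<close>
    obtain k0 where k0: "\<And>k. k0 \<le> k \<Longrightarrow> f k \<notin> K 0"
      using ev[of 0] unfolding eventually_sequentially by blast
    define g where "g k = f (k + k0)" for k
    have "\<exists>n. g k \<in> alpha_cut \<alpha> (us n)" for k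
      using f k0[of "k + k0"] unfolding g_def K_def by fastforce
    then obtain m where m: "\<And>k. g k \<in> alpha_cut \<alpha> (us (m k))" by metis
    have "filterlim m at_top sequentially"
      unfolding filterlim_at_top
    proof
      fix N
      have "\<forall>\<^sub>F k in sequentially. g k \<notin> K N"
        using ev[of N] unfolding g_def by (rule sequentially_offset)
      then show "\<forall>\<^sub>F k in sequentially. N \<le> m k"
        by (rule eventually_mono) (use m in \<open>force simp: K_def\<close>)
    qed
    then have Hm: "(\<lambda>k. H_end (us (m k)) u) \<longlonglongrightarrow> 0"
      using H by (rule filterlim_compose[rotated])
    have "(g k, \<alpha>) \<in> endograph (us (m k))" for k
      using m[of k] \<alpha> by (simp add: endograph_iff alpha_cut_pos)
    then obtain q where q: "\<And>k. q k \<in> endograph u" "(\<lambda>k. dbar (g k, \<alpha>) (q k)) \<longlonglongrightarrow> 0"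
      using H_end_approximating_sequence(1)[OF F_USCG_fuzzy[OF u], of "\<lambda>k. us (m k)" "\<lambda>k. (g k, \<alpha>)"]
        F_USCG_fuzzy[OF us] Hm by blast
    have "\<forall>\<^sub>F k in sequentially. dbar (g k, \<alpha>) (q k) < \<alpha> / 2"
      using \<alpha> by (intro order_tendstoD(2)[OF q(2)]) simp
    then have "\<forall>\<^sub>F k in sequentially. q k \<in> endograph u \<inter> {p. \<alpha> / 2 \<le> snd p}"
    proof (rule eventually_mono)
      fix k assume "dbar (g k, \<alpha>) (q k) < \<alpha> / 2"
      then have "\<bar>\<alpha> - snd (q k)\<bar> < \<alpha> / 2"
        using zero_le_dist[of "g k" "fst (q k)"] by (simp add: dbar_def del: zero_le_dist)
      then have "\<alpha> / 2 \<le> snd (q k)" by linarith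
      then show "q k \<in> endograph u \<inter> {p. \<alpha> / 2 \<le> snd p}" using q(1) by blast
    qed
    then have freq: "\<exists>\<^sub>F k in sequentially. q k \<in> endograph u \<inter> {p. \<alpha> / 2 \<le> snd p}"
      by (intro eventually_frequently) auto
    have "compact (endograph u \<inter> {p. \<alpha> / 2 \<le> snd p})"
      using \<alpha> by (intro compact_endograph_above[OF u]) auto
    then obtain z r where "z \<in> endograph u \<inter> {p. \<alpha> / 2 \<le> snd p}"
      and r: "strict_mono (r :: nat \<Rightarrow> nat)" and lim: "(q \<circ> r) \<longlonglongrightarrow> z"
      using freq by (rule subsequence_in_compact)
    then have z: "z \<in> endograph u" by blast
    have "(\<lambda>j. dbar ((q \<circ> r) j) (g (r j), \<alpha>)) \<longlonglongrightarrow> 0"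
      using LIMSEQ_subseq_LIMSEQ[OF q(2) r] by (simp add: o_def dbar_commute)
    then have "(\<lambda>j. (g (r j), \<alpha>)) \<longlonglongrightarrow> z" using lim by (rule dbar_tendsto_0_transfer)
    from tendsto_fst[OF this] tendsto_snd[OF this]
    have lims: "(\<lambda>j. g (r j)) \<longlonglongrightarrow> fst z" "snd z = \<alpha>"
      by (auto simp: tendsto_const_iff)
    then have "fst z \<in> ?U" using z \<alpha> by (simp add: endograph_iff alpha_cut_pos)
    moreover have "(f \<circ> (\<lambda>j. r j + k0)) \<longlonglongrightarrow> fst z" using lims(1) by (simp add: g_def o_def)
    moreover have "strict_mono (\<lambda>j. r j + k0)" using r by (simp add: strict_mono_def)
    ultimately show ?thesis by blast
  qed
qed

section \<open>From Kuratowski convergence and relative compactness to endograph convergence\<close>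

text \<open>A point of height less than \<open>e\<close> is within \<open>e\<close> of the zero level, which every endograph
  contains.\<close>

lemma height_ge_if_far:
  assumes "v \<in> fuzzy_sets" "p \<in> endograph u" "\<And>q. q \<in> endograph v \<Longrightarrow> e \<le> dbar p q"
  shows "e \<le> snd p"
  using assms(2) assms(3)[OF endograph_base[OF assms(1), of "fst p"]]
  by (simp add: dbar_def endograph_iff)

lemma tendsto_common_limit_dbar_less:
  assumes "p \<longlonglongrightarrow> z" "q \<longlonglongrightarrow> z" "0 < e"
  shows "\<exists>k::nat. dbar (p k) (q k) < e"
proof -
  have "(\<lambda>k. dbar (p k) z + dbar (q k) z) \<longlonglongrightarrow> 0 + 0"
    using assms(1,2) unfolding tendsto_iff_dbar_tendsto_0 by (rule tendsto_add)
  then have "\<forall>\<^sub>F k in sequentially. dbar (p k) z + dbar (q k) z < e"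
    using assms(3) by (intro order_tendstoD(2)) simp_all
  then obtain k where "dbar (p k) z + dbar (q k) z < e"
    using eventually_happens trivial_limit_sequentially by blast
  moreover have "dbar (p k) (q k) \<le> dbar (p k) z + dbar (q k) z"
    using dist_triangle2[of "fst (p k)" "fst (q k)" "fst z"] by (simp add: dbar_def)
  ultimately show ?thesis by (intro exI[of _ k]) simp
qed

lemma H_end_tendsto_0I:
  assumes "u \<in> fuzzy_sets" "\<And>n. us n \<in> fuzzy_sets"
    and "\<And>e. 0 < e \<Longrightarrow> \<forall>\<^sub>F n in sequentially. \<forall>p\<in>endograph (us n). \<exists>q\<in>endograph u. dbar p q < e"
    and "\<And>e. 0 < e \<Longrightarrow> \<forall>\<^sub>F n in sequentially. \<forall>q\<in>endograph u. \<exists>p\<in>endograph (us n). dbar p q < e"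
  shows "(\<lambda>n. H_end (us n) u) \<longlonglongrightarrow> 0"
proof (rule tendstoI)
  fix e :: real assume "0 < e"
  then have "0 < e / 2" by simp
  from assms(3,4)[OF this] show "\<forall>\<^sub>F n in sequentially. dist (H_end (us n) u) 0 < e"
  proof eventually_elim
    case (elim n)
    have "hausdorff dbar (endograph (us n)) (endograph u) \<le> ereal (e / 2)"
      using elim by (intro hausdorff_le) (meson less_imp_le)+
    then show ?case
      using hausdorff_endograph[OF assms(2)[of n] assms(1)] \<open>0 < e\<close> by simp
  qed
qed

text \<open>Points far from the other endograph are high and therefore subconverge.  A limit of points of
  the endographs of \<open>us n\<close> lies in the endograph of \<open>u\<close> by the limsup condition; a limit of points of
  the endograph of \<open>u\<close> is itself approximated from the endographs of \<open>us n\<close> by the liminf condition.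
  Either way the distance to the other endograph drops below \<open>e\<close>.\<close>

lemma H_end_tendsto_if_Gamma:
  assumes u: "u \<in> F_USCG" and us: "\<And>n. us n \<in> F_USCG" and G: "Gamma_converges us u"
    and rc: "\<And>\<alpha>. \<lbrakk>0 < \<alpha>; \<alpha> \<le> 1\<rbrakk> \<Longrightarrow> relatively_compact (\<Union>n. alpha_cut \<alpha> (us n))"
  shows "(\<lambda>n. H_end (us n) u) \<longlonglongrightarrow> 0"
proof (rule H_end_tendsto_0I)
  note fuzzy = F_USCG_fuzzy[OF u] F_USCG_fuzzy[OF us]
  show "u \<in> fuzzy_sets" "\<And>n. us n \<in> fuzzy_sets" by (rule fuzzy)+
  have sup: "z \<in> endograph u"
    if "strict_mono (r :: nat \<Rightarrow> nat)" "\<And>j. s j \<in> endograph (us (r j))" "s \<longlonglongrightarrow> z" for r s z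
    using G that unfolding Gamma_converges_def K_converges_def K_limsup_endograph by blast
  have inf: "\<exists>s. (\<forall>n. s n \<in> endograph (us n)) \<and> s \<longlonglongrightarrow> z" if "z \<in> endograph u" for z
    using G that unfolding Gamma_converges_def K_converges_def K_liminf_endograph by blast
  fix e :: real assume e: "0 < e"
  show "\<forall>\<^sub>F n in sequentially. \<forall>p\<in>endograph (us n). \<exists>q\<in>endograph u. dbar p q < e"
  proof (rule ccontr)
    assume "\<not> ?thesis"
    then obtain r where r: "strict_mono (r :: nat \<Rightarrow> nat)"
      and "\<forall>j. \<exists>p\<in>endograph (us (r j)). \<forall>q\<in>endograph u. e \<le> dbar p q"
      using not_eventually_sequentiallyD by (fastforce simp: not_less)
    then obtain p where p: "\<And>j. p j \<in> endograph (us (r j))"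
      and far: "\<And>j q. q \<in> endograph u \<Longrightarrow> e \<le> dbar (p j) q"
      by metis
    have height: "e \<le> snd (p j)" "snd (p j) \<le> 1" for j
      using height_ge_if_far[OF fuzzy(1) p far] p by (auto simp: endograph_iff)
    then have "e \<le> 1" using order_trans by blast
    let ?K = "closure (\<Union>n. alpha_cut e (us n)) \<times> {e..1}"
    have "compact ?K"
      using rc[OF e \<open>e \<le> 1\<close>] by (intro compact_Times) (auto simp: relatively_compact_def)
    moreover have "p j \<in> ?K" for j
    proof -
      have "fst (p j) \<in> alpha_cut e (us (r j))"
        using p[of j] height[of j] e by (simp add: endograph_iff alpha_cut_pos)
      then show ?thesis using height[of j] closure_subset by (fastforce simp: mem_Times_iff)
    qed
    then have "\<exists>\<^sub>F j in sequentially. p j \<in> ?K" by (simp add: frequently_const)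
    ultimately obtain z k where "z \<in> ?K"
      and k: "strict_mono (k :: nat \<Rightarrow> nat)" and lim: "(p \<circ> k) \<longlonglongrightarrow> z"
      by (rule subsequence_in_compact)
    have "z \<in> endograph u"
      using p by (intro sup[OF strict_mono_o[OF r k] _ lim]) simp
    moreover obtain j where "dbar (p (k j)) z < e"
      using tendsto_common_limit_dbar_less[OF lim tendsto_const e] by auto
    ultimately show False using far by (meson not_le)
  qed
  show "\<forall>\<^sub>F n in sequentially. \<forall>q\<in>endograph u. \<exists>p\<in>endograph (us n). dbar p q < e"
  proof (rule ccontr)
    assume "\<not> ?thesis"
    then obtain r where r: "strict_mono (r :: nat \<Rightarrow> nat)"
      and "\<forall>j. \<exists>q\<in>endograph u. \<forall>p\<in>endograph (us (r j)). e \<le> dbar p q"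
      using not_eventually_sequentiallyD by (fastforce simp: not_less)
    then obtain q where q: "\<And>j. q j \<in> endograph u"
      and far: "\<And>j p. p \<in> endograph (us (r j)) \<Longrightarrow> e \<le> dbar p (q j)"
      by metis
    have far': "e \<le> dbar (q j) p" if "p \<in> endograph (us (r j))" for j p
      using far[OF that] by (simp add: dbar_commute)
    have height: "e \<le> snd (q j)" "snd (q j) \<le> 1" for j
      using height_ge_if_far[OF fuzzy(2) q far'] q by (auto simp: endograph_iff)
    then have "e \<le> 1" using order_trans by blast
    then have "compact (endograph u \<inter> {p. e \<le> snd p})" by (rule compact_endograph_above[OF u e])
    moreover have "\<exists>\<^sub>F j in sequentially. q j \<in> endograph u \<inter> {p. e \<le> snd p}"
      using q height by (simp add: frequently_const)
    ultimately obtain z k where "z \<in> endograph u \<inter> {p. e \<le> snd p}"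
      and k: "strict_mono (k :: nat \<Rightarrow> nat)" and lim: "(q \<circ> k) \<longlonglongrightarrow> z"
      by (rule subsequence_in_compact)
    then have z: "z \<in> endograph u" by blast
    obtain s where s: "\<And>n. s n \<in> endograph (us n)" "s \<longlonglongrightarrow> z" using inf[OF z] by blast
    have "(s \<circ> (r \<circ> k)) \<longlonglongrightarrow> z"
      using s(2) strict_mono_o[OF r k] by (rule LIMSEQ_subseq_LIMSEQ)
    then obtain j where "dbar (s (r (k j))) (q (k j)) < e"
      using tendsto_common_limit_dbar_less[OF _ lim e, of "s \<circ> (r \<circ> k)"] by auto
    then show False using far[OF s(1)] by (meson not_le)
  qed
qed

section \<open>The equivalence\<close>

lemma closedin_range_with_limit:
  assumes "Metric_space M d" "\<And>n. \<sigma> n \<in> M" "l \<in> M" "(\<lambda>n. d (\<sigma> n) l) \<longlonglongrightarrow> 0"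
  shows "closedin (Metric_space.mtopology M d) (range \<sigma> \<union> {l})"
proof -
  interpret Metric_space M d by (rule assms(1))
  have "limitin mtopology \<sigma> l sequentially"
    using assms by (simp add: limitin_metric_dist_null)
  then have "compactin mtopology (insert l (range \<sigma>))"
    using assms(2) by (intro compactin_sequence_with_limit) auto
  then show ?thesis
    using compactin_imp_closedin[OF Hausdorff_space_mtopology] by simp
qed

lemma relatively_compact_subset_compact:
  fixes A :: "'a::metric_space set"
  assumes "compact K" "A \<subseteq> K"
  shows "relatively_compact A"
  unfolding relatively_compact_def
proof -
  have "closure A \<subseteq> K" using assms by (intro closure_minimal compact_imp_closed)
  then show "compact (closure A)"
    using compact_Int_closed[OF assms(1) closed_closure[of A]] by (simp add: inf.absorb2)
qed

theorem proposition7p2: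
  fixes u :: "'a::metric_space \<Rightarrow> real" and us :: "nat \<Rightarrow> 'a \<Rightarrow> real"
  assumes "u \<in> F_USCG" and "\<And>n. us n \<in> F_USCG"
  shows
    "let
       i = ((\<lambda>n. H_end (us n) u) \<longlonglongrightarrow> 0);
       ii = (Gamma_converges us u \<and>
             (\<forall>\<alpha>\<in>{0<..1}. relatively_compact (\<Union>n. alpha_cut \<alpha> (us n))));
       iii = (Gamma_converges us u \<and>
              (\<forall>\<alpha>\<in>{0<..1}. compact ((\<Union>n. alpha_cut \<alpha> (us n)) \<union> alpha_cut \<alpha> u)));
       iv = (Gamma_converges us u \<and>
             closedin (Metric_space.mtopology F_USCG H_end) (range us \<union> {u}) \<and>
             (\<forall>\<alpha>\<in>{0<..1}. compact ((\<Union>n. alpha_cut \<alpha> (us n)) \<union> alpha_cut \<alpha> u)))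
     in (i \<longleftrightarrow> ii) \<and> (i \<longleftrightarrow> iii) \<and> (i \<longleftrightarrow> iv)"
proof -
  have i_G: "Gamma_converges us u" if "(\<lambda>n. H_end (us n) u) \<longlonglongrightarrow> 0"
    using Gamma_if_H_end_tendsto[OF _ F_USCG_fuzzy[OF assms(2)] that] assms(1)
    by (simp add: F_USCG_def)
  have i_cpt: "\<forall>\<alpha>\<in>{0<..1}. compact ((\<Union>n. alpha_cut \<alpha> (us n)) \<union> alpha_cut \<alpha> u)"
    if "(\<lambda>n. H_end (us n) u) \<longlonglongrightarrow> 0"
    using compact_Union_cuts_if_H_end_tendsto[OF assms that] by simp
  have i_cl: "closedin (Metric_space.mtopology F_USCG H_end) (range us \<union> {u})"
    if "(\<lambda>n. H_end (us n) u) \<longlonglongrightarrow> 0"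
    using that assms by (intro closedin_range_with_limit Metric_space_H_end) (auto simp: F_USCG_def)
  have cpt_rc: "\<forall>\<alpha>\<in>{0<..1}. relatively_compact (\<Union>n. alpha_cut \<alpha> (us n))"
    if "\<forall>\<alpha>\<in>{0<..1}. compact ((\<Union>n. alpha_cut \<alpha> (us n)) \<union> alpha_cut \<alpha> u)"
    using that by (meson Un_upper1 relatively_compact_subset_compact)
  have ii_i: "(\<lambda>n. H_end (us n) u) \<longlonglongrightarrow> 0"
    if "Gamma_converges us u" "\<forall>\<alpha>\<in>{0<..1}. relatively_compact (\<Union>n. alpha_cut \<alpha> (us n))"
    using H_end_tendsto_if_Gamma[OF assms that(1)] that(2) by simp
  show ?thesis
    unfolding Let_def using i_G i_cpt i_cl cpt_rc ii_i by blast
qed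

end
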